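(* Let $\mathbb{F}_q$ be a finite field with $q$ elements, let $P(X,Z)\in\mathbb{F}_q[X,Z]$ be monic in $Z$ with $\deg_Z P\ge 2$, and let $Q(X,Y,Z)\in\mathbb{F}_q[X,Y,Z]$ be monic in $Y$ with $\deg_Y Q\ge 2$. Let $\chi_1$ be a fixed nontrivial additive character of $\mathbb{F}_q$, and let $$N_0'=\#\{(\beta,\gamma)\in\mathbb{F}_q^2\mid P(0,\gamma)=0,\ Q(0,\beta,\gamma)=0\}.$$ If $P(0,Z)$ has $r$ distinct roots in $\mathbb{F}_q$, then $$N_0'=r+\frac{1}{q}\sum_{\substack{\gamma\in\mathbb{F}_q\\ P(0,\gamma)=0}}\ \sum_{s\in\mathbb{F}_q^\times}\ \sum_{\beta\in\mathbb{F}_q}\chi_1\bigl(s\,Q(0,\beta,\gamma)\bigr).$$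
   Context: An additive character of $\mathbb{F}_q$ is a group homomorphism from $(\mathbb{F}_q,+)$ to the complex numbers of absolute value $1$; it is nontrivial if it is not identically $1$. "Monic in $Z$" means leading coefficient $1$ as a polynomial in $Z$ over the polynomial ring in the other variables; similarly for $Y$. $\mathbb{F}_q^\times=\mathbb{F}_q\setminus\{0\}$. *)

theory Defs
  imports Complex_Main "HOL-Computational_Algebra.Polynomial"
begin

(* Multivariate polynomials are iterated univariate ones, the outermost variable being the one
   with respect to which monicity and degree are taken:
     F[X,Z] = (F[X])[Z]  is  'a poly poly,
     F[X,Y,Z] = ((F[X])[Z])[Y]  is  'a poly poly poly.
   Hence "monic in Z" (resp. "monic in Y") is lead_coeff _ = 1, and deg_Z (resp. deg_Y) is degree. *)

text \<open>The univariate polynomial \<open>P(x,Z)\<close>, for \<open>P \<in> F[X][Z]\<close>.\<close>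

definition spec_X :: "'a::comm_semiring_0 poly poly \<Rightarrow> 'a \<Rightarrow> 'a poly" where
  "spec_X P x = map_poly (\<lambda>c. poly c x) P"

text \<open>The value \<open>P(x,z)\<close>.\<close>

definition eval_XZ :: "'a::comm_semiring_0 poly poly \<Rightarrow> 'a \<Rightarrow> 'a \<Rightarrow> 'a" where
  "eval_XZ P x z = poly (spec_X P x) z"

text \<open>The value \<open>Q(x,y,z)\<close>, for \<open>Q \<in> F[X][Z][Y]\<close>. The arguments are in the order
  \<open>X, Y, Z\<close>, although \<open>Y\<close> is the outermost variable.\<close>

definition eval_XYZ ::
  "'a::comm_semiring_0 poly poly poly \<Rightarrow> 'a \<Rightarrow> 'a \<Rightarrow> 'a \<Rightarrow> 'a" where
  "eval_XYZ Q x y z = poly (map_poly (\<lambda>c. eval_XZ c x z) Q) y"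

definition additive_character :: "('a::ab_group_add \<Rightarrow> complex) \<Rightarrow> bool" where
  "additive_character \<chi> \<longleftrightarrow>
     (\<forall>a. cmod (\<chi> a) = 1) \<and> (\<forall>a b. \<chi> (a + b) = \<chi> a * \<chi> b)"

definition nontrivial_character :: "('a \<Rightarrow> complex) \<Rightarrow> bool" where
  "nontrivial_character \<chi> \<longleftrightarrow> \<not> (\<forall>a. \<chi> a = 1)"

end

theory Submission
  imports Defs
begin

text \<open>By orthogonality, \<open>\<Sum>s. \<chi> (s * u)\<close> is \<open>q\<close> if \<open>u = 0\<close> and \<open>0\<close> otherwise, so that
  \<open>q * #{\<beta>. Q(0,\<beta>,\<gamma>) = 0}\<close> is the double sum of \<open>\<chi> (s * Q(0,\<beta>,\<gamma>))\<close> over all \<open>s\<close> and \<open>\<beta>\<close>. The term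
  \<open>s = 0\<close> contributes \<open>q\<close> for each of the \<open>r\<close> roots \<open>\<gamma>\<close>, and after division by \<open>q\<close> this is
  the summand \<open>r\<close>.\<close>

lemma additive_character_zero:
  assumes "additive_character \<chi>"
  shows "\<chi> 0 = 1"
proof -
  have "\<chi> 0 = \<chi> 0 * \<chi> 0" and "\<chi> 0 \<noteq> 0"
    using assms unfolding additive_character_def
    by (metis add_0, metis norm_zero zero_neq_one)
  then show ?thesis by simp
qed

text \<open>Shifting the summation variable by some \<open>b\<close> with
  \<open>\<chi> b \<noteq> 1\<close> leaves the sum unchanged but also multiplies it by
  \<open>\<chi> b\<close>, which forces it to be 0.\<close>

lemma sum_nontrivial_additive_character:
  fixes \<chi> :: "'a::{ab_group_add,finite} \<Rightarrow> complex"
  assumes "additive_character \<chi>" and "nontrivial_character \<chi>"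
  shows "(\<Sum>a\<in>UNIV. \<chi> a) = 0"
proof -
  obtain b where b: "\<chi> b \<noteq> 1"
    using assms(2) by (auto simp: nontrivial_character_def)
  have "(\<Sum>a\<in>UNIV. \<chi> a) = (\<Sum>a\<in>UNIV. \<chi> (b + a))"
    by (rule sum.reindex_bij_witness[of _ "\<lambda>a. b + a" "\<lambda>a. a - b"]) auto
  also have "\<dots> = \<chi> b * (\<Sum>a\<in>UNIV. \<chi> a)"
    using assms(1) by (simp add: additive_character_def sum_distrib_left)
  finally show ?thesis
    using b by simp
qed

text \<open>For nonzero \<open>u\<close>, multiplication by \<open>u\<close> permutes the field, so
  the sum is the full character sum; for \<open>u = 0\<close> every term is 1.\<close>

lemma sum_additive_character_mult:
  fixes \<chi> :: "'a::{field,finite} \<Rightarrow> complex"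
  assumes "additive_character \<chi>" and "nontrivial_character \<chi>"
  shows "(\<Sum>s\<in>UNIV. \<chi> (s * u)) = (if u = 0 then of_nat (card (UNIV :: 'a set)) else 0)"
proof (cases "u = 0")
  case True
  then show ?thesis
    using additive_character_zero[OF assms(1)] by simp
next
  case False
  then have "(\<Sum>s\<in>UNIV. \<chi> (s * u)) = (\<Sum>a\<in>UNIV. \<chi> a)"
    by (intro sum.reindex_bij_witness[of _ "\<lambda>a. a / u" "\<lambda>s. s * u"]) auto
  then show ?thesis
    using sum_nontrivial_additive_character[OF assms] False by simp
qed

text \<open>Multiplying through by the field size avoids division. The function \<open>f\<close> is
  arbitrary, so that \<gamma> can later be held fixed while \<beta> varies.\<close>

lemma card_zeros_eq_sum_additive_character:
  fixes \<chi> :: "'a::{field,finite} \<Rightarrow> complex" and f :: "'b::finite \<Rightarrow> 'a"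
  assumes "additive_character \<chi>" and "nontrivial_character \<chi>"
  shows "of_nat (card (UNIV :: 'a set)) * of_nat (card {x. f x = 0}) =
    of_nat (card (UNIV :: 'b set)) + (\<Sum>s\<in>UNIV - {0}. \<Sum>x\<in>UNIV. \<chi> (s * f x))"
proof -
  have "of_nat (card (UNIV :: 'a set)) * of_nat (card {x. f x = 0}) =
      (\<Sum>x\<in>UNIV. \<Sum>s\<in>UNIV. \<chi> (s * f x))"
    by (simp add: sum_additive_character_mult[OF assms] sum.If_cases)
  also have "\<dots> = (\<Sum>s\<in>UNIV. \<Sum>x\<in>UNIV. \<chi> (s * f x))"
    by (rule sum.swap)
  also have "\<dots> = (\<Sum>x\<in>UNIV. \<chi> (0 * f x)) + (\<Sum>s\<in>UNIV - {0}. \<Sum>x\<in>UNIV. \<chi> (s * f x))"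
    by (rule sum.remove) auto
  finally show ?thesis
    using additive_character_zero[OF assms(1)] by simp
qed

theorem theorem4p12:
  fixes P :: "'a::{field,finite} poly poly"
    and Q :: "'a poly poly poly"
    and \<chi>\<^sub>1 :: "'a \<Rightarrow> complex"
    and q r N\<^sub>0' :: nat
  assumes "q = card (UNIV :: 'a set)"
    and "lead_coeff P = 1" and "degree P \<ge> 2"
    and "lead_coeff Q = 1" and "degree Q \<ge> 2"
    and "additive_character \<chi>\<^sub>1" and "nontrivial_character \<chi>\<^sub>1"
    and "N\<^sub>0' = card {(\<beta>, \<gamma>). eval_XZ P 0 \<gamma> = 0 \<and> eval_XYZ Q 0 \<beta> \<gamma> = 0}"
    and "card {\<gamma>. poly (spec_X P 0) \<gamma> = 0} = r"
  shows "of_nat N\<^sub>0' = of_nat r + 1 / of_nat q *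
           (\<Sum>\<gamma> | eval_XZ P 0 \<gamma> = 0. \<Sum>s\<in>UNIV - {0}. \<Sum>\<beta>\<in>UNIV. \<chi>\<^sub>1 (s * eval_XYZ Q 0 \<beta> \<gamma>))"
proof -
  let ?R = "{\<gamma>. eval_XZ P 0 \<gamma> = 0}"
  let ?Z = "\<lambda>\<gamma>. {\<beta>. eval_XYZ Q 0 \<beta> \<gamma> = 0}"
  let ?S = "\<lambda>\<gamma>. \<Sum>s\<in>UNIV - {0}. \<Sum>\<beta>\<in>UNIV. \<chi>\<^sub>1 (s * eval_XYZ Q 0 \<beta> \<gamma>)"
  have q: "(of_nat q :: complex) \<noteq> 0"
    using assms(1) by simp
  have r: "card ?R = r"
    using assms(9) by (simp add: eval_XZ_def)
  \<comment> \<open>Swapping coordinates puts \<gamma> first, so that the solutions fibre over the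
    roots of P(0,Z).\<close>
  have "N\<^sub>0' = card (SIGMA \<gamma>:?R. ?Z \<gamma>)"
    unfolding assms(8)
    by (rule bij_betw_same_card[of prod.swap], rule bij_betw_byWitness[of _ prod.swap]) auto
  then have "N\<^sub>0' = (\<Sum>\<gamma>\<in>?R. card (?Z \<gamma>))"
    by simp
  then have "of_nat q * of_nat N\<^sub>0' = (\<Sum>\<gamma>\<in>?R. of_nat q * (of_nat (card (?Z \<gamma>)) :: complex))"
    by (simp add: sum_distrib_left)
  \<comment> \<open>Here \<open>f\<close> is \<beta> \<mapsto> Q(0,\<beta>,\<gamma>), whose domain
    is the field itself; hence the term for \<open>s = 0\<close> is again \<open>q\<close>.\<close>
  also have "\<dots> = (\<Sum>\<gamma>\<in>?R. of_nat q + ?S \<gamma>)"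
    unfolding assms(1) by (intro sum.cong card_zeros_eq_sum_additive_character assms(6,7) refl)
  also have "\<dots> = of_nat q * of_nat r + (\<Sum>\<gamma>\<in>?R. ?S \<gamma>)"
    by (simp add: sum.distrib r)
  finally show ?thesis
    using q by (simp add: field_simps)
qed

end
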